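(* Let $A\in\mathbb{R}^{N\times N}$ be a (sparse) matrix with adjacency graph $\mathbb{G}$. Then $(A,\mathbb{G})$ is a GIRS-1 matrix; that is, for every induced subgraph $\mathbb{H}$ of $\mathbb{G}$, $\operatorname{rank}(A_{\overline{\mathbb{H}},\mathbb{H}})\le\rho(\mathbb{H})$.
   Context: The adjacency graph of $A\in\mathbb{R}^{N\times N}$ is the undirected graph on vertices $\{1,\ldots,N\}$ in which distinct $i,j$ are joined by an edge iff $A_{ij}\ne0$ or $A_{ji}\neq 0$. For an induced subgraph $\mathbb{H}$ of $\mathbb{G}$, $\overline{\mathbb{H}}$ is the induced subgraph on the complementary vertex set, $A_{\overline{\mathbb{H}},\mathbb{H}}$ is the submatrix with rows indexed by the vertices of $\overline{\mathbb{H}}$ and columns indexed by the vertices of $\mathbb{H}$, and $\rho(\mathbb{H})$ is the number of edges of $\mathbb{G}$ joining a vertex of $\mathbb{H}$ to a vertex of $\overline{\mathbb{H}}$. For $c>0$, $(A,\mathbb{G})$ is a GIRS-$c$ matrix (graph-induced rank structure) if $\operatorname{rank}(A_{\overline{\mathbb{H}},\mathbb{H}})\le c\,\rho(\mathbb{H})$ for all induced subgraphs $\mathbb{H}$. *)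

theory Defs
  imports Jordan_Normal_Form.DL_Rank Jordan_Normal_Form.DL_Submatrix
begin

(* Undirected loop-free graphs; an edge joining i and j is the two-element set {i, j}.
   Following Jordan_Normal_Form, matrices have 0-based indices, so the vertices
   1, ..., N become 0, ..., N - 1. *)
record 'a ugraph =
  verts :: "'a set"
  edges :: "'a set set"

definition wf_ugraph :: "'a ugraph \<Rightarrow> bool" where
  "wf_ugraph G \<longleftrightarrow> (\<forall>e \<in> edges G. e \<subseteq> verts G \<and> card e = 2)"

definition adjacency_graph :: "'a :: zero mat \<Rightarrow> nat ugraph" where
  "adjacency_graph A = \<lparr>verts = {0..<dim_row A},
     edges = {{i, j} | i j. i \<in> {0..<dim_row A} \<and> j \<in> {0..<dim_row A} \<and> i \<noteq> j \<and>
                            (A $$ (i, j) \<noteq> 0 \<or> A $$ (j, i) \<noteq> 0)}\<rparr>"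

definition induced_by :: "'a ugraph \<Rightarrow> 'a set \<Rightarrow> 'a ugraph" where
  "induced_by G W = \<lparr>verts = W, edges = {e \<in> edges G. e \<subseteq> W}\<rparr>"

definition induced_subgraph :: "'a ugraph \<Rightarrow> 'a ugraph \<Rightarrow> bool" where
  "induced_subgraph H G \<longleftrightarrow> (\<exists>W \<subseteq> verts G. H = induced_by G W)"

definition compl_subgraph :: "'a ugraph \<Rightarrow> 'a ugraph \<Rightarrow> 'a ugraph" where
  "compl_subgraph G H = induced_by G (verts G - verts H)"

definition rho :: "'a ugraph \<Rightarrow> 'a ugraph \<Rightarrow> nat" where
  "rho G H = card {e \<in> edges G. \<exists>u \<in> verts H. \<exists>v \<in> verts (compl_subgraph G H). e = {u, v}}"

definition off_diag_block :: "'a mat \<Rightarrow> nat ugraph \<Rightarrow> nat ugraph \<Rightarrow> 'a mat" where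
  "off_diag_block A G H = submatrix A (verts (compl_subgraph G H)) (verts H)"

(* vec_space.rank takes the dimension of the ambient column space as its first argument. *)
definition mat_rank :: "'a :: field mat \<Rightarrow> nat" where
  "mat_rank B = vec_space.rank (dim_row B) B"

definition GIRS :: "real \<Rightarrow> real mat \<Rightarrow> nat ugraph \<Rightarrow> bool" where
  "GIRS c A G \<longleftrightarrow> c > 0 \<and> square_mat A \<and> wf_ugraph G \<and> verts G = {0..<dim_row A} \<and>
     (\<forall>H. induced_subgraph H G \<longrightarrow> real (mat_rank (off_diag_block A G H)) \<le> c * real (rho G H))"

end

theory Submission imports Defs begin

text \<open>A matrix is the sum of its single-entry parts, each of rank at most one, so its rank is at
  most the number of its nonzero entries. Sending the nonzero entry of the off-diagonal block in
  row \<open>i\<close> and column \<open>j\<close> to the edge \<open>{i, j}\<close> is injective because row and column indices come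
  from disjoint vertex sets, so these entries are no more numerous than the edges between the
  subgraph and its complement.\<close>

definition nonzero_positions :: "'a :: zero mat \<Rightarrow> (nat \<times> nat) set" where
  "nonzero_positions B = {(i, j). i < dim_row B \<and> j < dim_col B \<and> B $$ (i, j) \<noteq> 0}"

lemma finite_nonzero_positions [simp]: "finite (nonzero_positions B)"
  by (rule finite_subset[of _ "{..<dim_row B} \<times> {..<dim_col B}"])
     (auto simp: nonzero_positions_def)

text \<open>Induction on the number of nonzero entries: splitting off one of them as a separate
  summand costs at most one in rank, by subadditivity.\<close>

lemma (in vec_space) rank_le_card_nonzero_positions:
  assumes "B \<in> carrier_mat n nc"
  shows "rank B \<le> card (nonzero_positions B)"
  using assms
proof (induction "card (nonzero_positions B)" arbitrary: B)
  case 0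
  then have "nonzero_positions B = {}" by simp
  with 0 have "B = 0\<^sub>m n nc"
    by (intro eq_matI) (auto simp: nonzero_positions_def)
  then show ?case by (simp add: rank_0I)
next
  case (Suc k)
  then obtain r c where rc: "(r, c) \<in> nonzero_positions B"
    by (metis card.empty ex_in_conv nat.distinct(1) surj_pair)
  define E where "E = mat n nc (\<lambda>p. if p = (r, c) then B $$ (r, c) else 0)"
  define B' where "B' = mat n nc (\<lambda>p. if p = (r, c) then 0 else B $$ p)"
  have carrier: "E \<in> carrier_mat n nc" "B' \<in> carrier_mat n nc"
    by (simp_all add: E_def B'_def)
  have "nonzero_positions B' = nonzero_positions B - {(r, c)}"
    using Suc.prems by (auto simp: nonzero_positions_def B'_def split: if_splits)
  with rc Suc.hyps(2) have card_B': "card (nonzero_positions B') = k" by simp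
  have "B = E + B'"
    using Suc.prems by (intro eq_matI) (auto simp: E_def B'_def)
  then have "rank B \<le> rank E + rank B'"
    using rank_subadditive[OF carrier] by simp
  \<comment> \<open>\<open>E\<close> is the outer product of a multiple of the unit vector at
    \<open>r\<close> and the unit vector at \<open>c\<close>.\<close>
  also have "rank E \<le> 1"
    by (rule rank_le_1_product_entries[OF carrier(1),
          where f = "\<lambda>i. if i = r then B $$ (r, c) else 0" and g = "\<lambda>j. if j = c then 1 else 0"])
       (auto simp: E_def)
  also have "rank B' \<le> k"
    using Suc.hyps(1)[of B'] card_B' carrier by simp
  finally show ?case using Suc.hyps(2) by simp
qed

lemma mat_rank_le_card_nonzero_positions: "mat_rank B \<le> card (nonzero_positions B)"
  unfolding mat_rank_def
  by (rule vec_space.rank_le_card_nonzero_positions[of B "dim_row B" "dim_col B"]) auto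

text \<open>\<open>submatrix\<close> keeps only the indices of \<open>I\<close> below the dimension
  \<open>n\<close>, and for those positions \<open>pick\<close> on \<open>I\<close> agrees with
  \<open>pick\<close> on the truncated, finite set.\<close>

lemma pick_mem_less:
  assumes "i < card {a. a < n \<and> a \<in> I}"
  shows "pick I i \<in> I" "pick I i < n"
  using assms pick_in_set_le[of i "{a. a < n \<and> a \<in> I}"]
  by (auto simp: pick_reduce_set[OF assms])

text \<open>On the truncated set \<open>pick\<close> enumerates in strictly increasing
  order.\<close>

lemma inj_on_pick: "inj_on (pick I) {..<card {a. a < n \<and> a \<in> I}}"
proof (rule inj_onI)
  fix i j
  assume "i \<in> {..<card {a. a < n \<and> a \<in> I}}" "j \<in> {..<card {a. a < n \<and> a \<in> I}}"
    and "pick I i = pick I j"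
  then show "i = j"
    by (metis lessThan_iff pick_reduce_set pick_mono_le nat_neq_iff)
qed

lemma wf_adjacency_graph: "wf_ugraph (adjacency_graph A)"
  by (auto simp: wf_ugraph_def adjacency_graph_def card_2_iff)

lemma mat_rank_off_diag_block_le_rho:
  assumes A: "A \<in> carrier_mat N N"
    and H: "induced_subgraph H (adjacency_graph A)"
  shows "mat_rank (off_diag_block A (adjacency_graph A) H) \<le> rho (adjacency_graph A) H"
proof -
  define W where "W = verts H"
  define I where "I = {0..<N} - W"
  define B where "B = submatrix A I W"
  define F where "F = {e \<in> edges (adjacency_graph A). \<exists>u \<in> W. \<exists>v \<in> I. e = {u, v}}"
  have verts: "verts (compl_subgraph (adjacency_graph A) H) = I"
    using A by (auto simp: compl_subgraph_def induced_by_def adjacency_graph_def I_def W_def)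
  have dims: "dim_row B = card {a. a < N \<and> a \<in> I}" "dim_col B = card {a. a < N \<and> a \<in> W}"
    using A by (auto simp: B_def dim_submatrix)
  have pick: "pick I i \<in> I" "pick I i < N" if "i < dim_row B" for i
    using that pick_mem_less[of i N I] by (auto simp: dims)
  have pick': "pick W j \<in> W" "pick W j < N" if "j < dim_col B" for j
    using that pick_mem_less[of j N W] by (auto simp: dims)
  have disjoint: "I \<inter> W = {}" by (auto simp: I_def)
  define edge where "edge = (\<lambda>(i, j). {pick I i, pick W j})"
  have "inj_on edge (nonzero_positions B)"
  proof (rule inj_onI, clarify)
    fix i j i' j'
    assume ij: "(i, j) \<in> nonzero_positions B" and ij': "(i', j') \<in> nonzero_positions B"
      and eq: "edge (i, j) = edge (i', j')"
    from ij ij' have less: "i < dim_row B" "j < dim_col B" "i' < dim_row B" "j' < dim_col B"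
      by (auto simp: nonzero_positions_def)
    \<comment> \<open>Equal doubletons could also match crosswise, but that would put a row vertex
      from \<open>I\<close> into \<open>W\<close>.\<close>
    have "pick I i = pick I i'" "pick W j = pick W j'"
      using eq disjoint pick(1)[OF less(1)] pick(1)[OF less(3)]
        pick'(1)[OF less(2)] pick'(1)[OF less(4)]
      by (auto simp: edge_def doubleton_eq_iff)
    then show "i = i' \<and> j = j'"
      using less inj_on_pick[of I N] inj_on_pick[of W N] by (auto simp: dims dest: inj_onD)
  qed
  moreover have "edge ` nonzero_positions B \<subseteq> F"
  proof clarify
    fix i j assume "(i, j) \<in> nonzero_positions B"
    then have less: "i < dim_row B" "j < dim_col B" and nz: "B $$ (i, j) \<noteq> 0"
      by (auto simp: nonzero_positions_def)
    \<comment> \<open>The block entry at \<open>(i, j)\<close> is the entry of \<open>A\<close> at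
      the picked vertices.\<close>
    have "A $$ (pick I i, pick W j) \<noteq> 0"
      using nz less A by (auto simp: B_def submatrix_def)
    moreover have "pick I i \<noteq> pick W j"
      using disjoint pick(1)[OF less(1)] pick'(1)[OF less(2)] by auto
    ultimately have "edge (i, j) \<in> edges (adjacency_graph A)"
      using A pick[OF less(1)] pick'[OF less(2)]
      by (auto simp: edge_def adjacency_graph_def)
    \<comment> \<open>Reordered to fit \<open>F\<close>, whose edges name the endpoint in
      \<open>W\<close> first.\<close>
    moreover have "edge (i, j) = {pick W j, pick I i}"
      by (auto simp: edge_def)
    ultimately show "edge (i, j) \<in> F"
      unfolding F_def using pick(1)[OF less(1)] pick'(1)[OF less(2)] by blast
  qed
  \<comment> \<open>Comparing cardinalities along an injection requires a finite target, since
    \<open>card\<close> of an infinite set is 0.\<close>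
  moreover have "finite F"
    proof (rule finite_subset)
    show "F \<subseteq> Pow {0..<N}"
    proof
      fix e assume "e \<in> F"
      then have "e \<subseteq> verts (adjacency_graph A)"
        using wf_adjacency_graph[of A] by (simp add: F_def wf_ugraph_def)
      then show "e \<in> Pow {0..<N}"
        using A by (simp add: adjacency_graph_def)
    qed
  qed simp
  ultimately have "card (nonzero_positions B) \<le> card F"
    by (rule card_inj_on_le)
  then have "mat_rank B \<le> card F"
    using mat_rank_le_card_nonzero_positions[of B] by linarith
  then show ?thesis
    by (simp add: off_diag_block_def rho_def verts B_def F_def flip: W_def)
qed

theorem proposition2p2:
  fixes A :: "real mat" and N :: nat
  assumes "A \<in> carrier_mat N N"
  shows "GIRS 1 A (adjacency_graph A) \<and>
    (\<forall>H. induced_subgraph H (adjacency_graph A) \<longrightarrow>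
       mat_rank (off_diag_block A (adjacency_graph A) H) \<le> rho (adjacency_graph A) H)"
  using mat_rank_off_diag_block_le_rho[OF assms] wf_adjacency_graph[of A] assms
  \<comment> \<open>The graph stays folded while the rank bound is applied, and is unfolded
    afterwards to read off its vertex set.\<close>
  by (simp add: GIRS_def) (simp add: adjacency_graph_def)

end
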